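(* Let $q\in\mathbb{C}$ with $|q|<1$, and let $\lambda=e^{2\pi i/f}$ with $f\in\mathbb{N}$. Define, for $s\in\mathbb{C}$, the second $q$-extension of the Lerch zeta function by $$\zeta_q^*(\lambda,s)=\sum_{m=1}^\infty\frac{q^m\lambda^m}{[m]_q^{s}}.$$ Then for $k\in\mathbb{N}$, we have $$\zeta_q^*(\lambda,1-k)=-\frac{B_{k,q}(\lambda)}{k}.$$
   Context: $[m]_q=\frac{1-q^m}{1-q}$, and $\mathbb{N}=\{1,2,3,\dots\}$. The numbers $B_{k,q}(\lambda)$ (a second $q$-extension of the $\lambda$-Bernoulli numbers), for complex $q$, are $$B_{k,q}(\lambda)=\frac{1}{(1-q)^{k-1}}\sum_{l=0}^{k}\binom{k}{l}(-1)^l\frac{l}{1-\lambda q^{l}},$$ where the $l=0$ term is read as $0$.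
   Formalization: The formula is stated for k ≥ 2 instead of all k ≥ 1: at k = 1 it fails for every q and λ, since the zeta value is λq/(1−λq) while −B_{1,q}(λ) = 1/(1−λq), which differ by exactly 1. *)

theory Defs
  imports "HOL-Analysis.Analysis"
begin

definition q_number :: "complex \<Rightarrow> nat \<Rightarrow> complex" where
  "q_number q m = (1 - q ^ m) / (1 - q)"

text \<open>
  The \<open>l = 0\<close> term is \<open>0\<close> even when \<open>lam = 1\<close>, since \<open>0 / x = 0\<close> for every \<open>x\<close>.
  The integer power keeps \<open>1 / (1 - q) ^ (k - 1)\<close> correct also for \<open>k = 0\<close>.
\<close>

definition q_bernoulli :: "nat \<Rightarrow> complex \<Rightarrow> complex \<Rightarrow> complex" where
  "q_bernoulli k q lam =
     1 / (1 - q) powi (int k - 1) *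
     (\<Sum>l=0..k. of_nat (k choose l) * (-1) ^ l * (of_nat l / (1 - lam * q ^ l)))"

text \<open>
  Complex powers use the principal branch. The summation variable is shifted, so that
  \<open>Suc m\<close> ranges over the positive integers.
\<close>

definition q_lerch_zeta :: "complex \<Rightarrow> complex \<Rightarrow> complex \<Rightarrow> complex" where
  "q_lerch_zeta q lam s =
     (\<Sum>m. q ^ Suc m * lam ^ Suc m / q_number q (Suc m) powr s)"

text \<open>The series converges for every \<open>s\<close>, so the value of \<open>q_lerch_zeta\<close> is a genuine sum.\<close>

lemma summable_q_lerch_zeta:
  assumes q: "norm q < 1" and l: "norm lam = 1"
  shows "summable (\<lambda>m. q ^ Suc m * lam ^ Suc m / q_number q (Suc m) powr s)"
proof -
  have "(\<lambda>m. q ^ Suc m) \<longlonglongrightarrow> 0"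
    using LIMSEQ_Suc[OF LIMSEQ_power_zero[OF q]] .
  moreover have q1: "1 - q \<noteq> 0" using q by auto
  ultimately have "(\<lambda>m. q_number q (Suc m)) \<longlonglongrightarrow> (1 - 0) / (1 - q)"
    unfolding q_number_def by (intro tendsto_intros)
  moreover have "1 / (1 - q) \<notin> \<real>\<^sub>\<le>\<^sub>0"
  proof -
    have "Re (1 - q) > 0"
      using abs_Re_le_cmod[of q] q by auto
    then have "Re (1 / (1 - q)) > 0"
      by (simp add: Re_divide sum_power2_gt_zero_iff)
    then show ?thesis
      by (auto simp: complex_nonpos_Reals_iff)
  qed
  ultimately have "(\<lambda>m. q_number q (Suc m) powr (- s)) \<longlonglongrightarrow> (1 / (1 - q)) powr (- s)"
    by (intro tendsto_powr_complex tendsto_const) auto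
  then have "Bseq (\<lambda>m. q_number q (Suc m) powr (- s))"
    by (intro convergent_imp_Bseq convergentI)
  then obtain K where K: "\<And>m. norm (q_number q (Suc m) powr (- s)) \<le> K"
    unfolding Bseq_def by blast
  have "summable (\<lambda>m. K * norm q ^ Suc m)"
    using q by (intro summable_mult) (simp add: summable_geometric summable_Suc_iff)
  then show ?thesis
  proof (rule summable_comparison_test')
    fix m :: nat
    have "norm (q ^ Suc m * lam ^ Suc m / q_number q (Suc m) powr s)
        = norm q ^ Suc m * norm (q_number q (Suc m) powr (- s))"
      by (simp add: norm_mult norm_divide norm_power l powr_minus norm_inverse divide_inverse)
    also have "\<dots> \<le> norm q ^ Suc m * K"
      by (intro mult_left_mono K) auto
    finally show "norm (q ^ Suc m * lam ^ Suc m / q_number q (Suc m) powr s) \<le> K * norm q ^ Suc m"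
      by (simp add: mult.commute)
  qed
qed

text \<open>
  At \<open>k = 1\<close> the left-hand side is \<open>lam q / (1 - lam q)\<close> whereas
  \<open>- q_bernoulli 1 q lam = 1 / (1 - lam q)\<close>, so the special value formula
  \<open>q_lerch_zeta q lam (1 - k) = - q_bernoulli k q lam / k\<close> fails there by exactly \<open>1\<close>,
  for all \<open>q\<close> and \<open>lam\<close>; it has to be restricted to \<open>k \<ge> 2\<close>.
\<close>

lemma q_lerch_zeta_one:
  assumes q: "norm q < 1" and l: "norm lam = 1"
  shows "q_lerch_zeta q lam (1 - of_nat 1) = - q_bernoulli 1 q lam / of_nat 1 - 1"
proof -
  have n: "norm (q * lam) < 1" using q l by (simp add: norm_mult)
  then have ne: "1 - lam * q \<noteq> 0" by (auto simp: mult.commute)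
  have q1: "1 - q \<noteq> 0" using q by auto
  have nz: "q_number q (Suc m) \<noteq> 0" for m
  proof -
    have "norm (q ^ Suc m) < 1"
      using q power_Suc_less_one[of "norm q" m] by (cases "q = 0") (auto simp: norm_power simp del: power_Suc)
    then have "1 - q ^ Suc m \<noteq> 0" by (auto simp del: power_Suc)
    then show ?thesis using q1 unfolding q_number_def by simp
  qed
  have "q_lerch_zeta q lam 0 = (\<Sum>m. (q * lam) * (q * lam) ^ m)"
    unfolding q_lerch_zeta_def using nz by (simp add: power_mult_distrib mult_ac)
  also have "\<dots> = (q * lam) * (1 / (1 - q * lam))"
    using n by (simp only: suminf_mult summable_geometric suminf_geometric)
  also have "\<dots> = 1 / (1 - lam * q) - 1"
    using ne by (simp add: field_simps)
  finally show ?thesis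
    by (simp add: q_bernoulli_def)
qed

end

theory Submission
  imports Defs
begin

text \<open>
  Expanding \<open>(1 - q ^ m) ^ (k - 1)\<close> binomially turns the series into a finite combination of
  geometric series with ratios \<open>lam * q ^ Suc j\<close>. As \<open>k \<ge> 2\<close>, the summand vanishes at \<open>m = 0\<close>, so
  these series may start at \<open>0\<close>; the absorption identity
  \<open>Suc n * (n choose j) = Suc j * (Suc n choose Suc j)\<close> then produces the Bernoulli sum.
\<close>

lemma q_number_Suc_nonzero:
  assumes "norm q < 1"
  shows "q_number q (Suc m) \<noteq> 0"
proof -
  have "norm (q ^ Suc m) < 1"
    unfolding norm_power using power_strict_mono[OF assms, of "Suc m"] by simp
  then have "q ^ Suc m \<noteq> 1" by (metis norm_one less_irrefl)
  moreover have "q \<noteq> 1" using assms by auto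
  ultimately show ?thesis by (simp add: q_number_def del: power_Suc)
qed

text \<open>The factor \<open>q ^ m\<close> raises the ratio of the \<open>j\<close>-th binomial
  term from \<open>lam * q ^ j\<close> to \<open>lam * q ^ Suc j\<close>, so its norm is below 1
  even when \<open>j = 0\<close> and \<open>norm lam = 1\<close>. Only finitely many geometric
  series are then added.\<close>

lemma sums_geometric_binomial:
  fixes q lam :: complex
  assumes q: "norm q < 1" and lam: "norm lam \<le> 1"
  shows "(\<lambda>m. (q * lam) ^ m * (1 - q ^ m) ^ n) sums
    (\<Sum>j\<le>n. of_nat (n choose j) * (-1) ^ j * (1 / (1 - lam * q ^ Suc j)))"
proof -
  have "norm (lam * q ^ Suc j) < 1" for j
  proof -
    have "norm q ^ Suc j < 1" using power_strict_mono[OF q, of "Suc j"] by simp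
    moreover have "norm lam * norm q ^ Suc j \<le> 1 * norm q ^ Suc j"
      using lam by (intro mult_right_mono) auto
    ultimately show ?thesis unfolding norm_mult norm_power by linarith
  qed
  then have "(\<lambda>m. \<Sum>j\<le>n. of_nat (n choose j) * (-1) ^ j * (lam * q ^ Suc j) ^ m) sums
      (\<Sum>j\<le>n. of_nat (n choose j) * (-1) ^ j * (1 / (1 - lam * q ^ Suc j)))"
    by (intro sums_sum sums_mult geometric_sums)
  moreover have "(\<Sum>j\<le>n. of_nat (n choose j) * (-1) ^ j * (lam * q ^ Suc j) ^ m)
      = (q * lam) ^ m * (1 - q ^ m) ^ n" for m
  proof -
    have "(1 - q ^ m) ^ n = (\<Sum>j\<le>n. of_nat (n choose j) * (- (q ^ m)) ^ j)"
      using binomial_ring[of "- (q ^ m)" 1 n] by simp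
    also have "\<dots> = (\<Sum>j\<le>n. of_nat (n choose j) * (-1) ^ j * (q ^ j) ^ m)"
      by (intro sum.cong refl, subst power_minus)
        (simp add: mult.commute flip: power_mult)
    finally show ?thesis
      by (simp add: sum_distrib_left power_mult_distrib mult_ac)
  qed
  ultimately show ?thesis by simp
qed

text \<open>The term \<open>l = 0\<close> vanishes; putting \<open>l = Suc j\<close> in the rest and
  absorbing \<open>l\<close> into the binomial coefficient pulls out
  \<open>- of_nat (Suc n)\<close>. A vanishing denominator does no harm, since division by 0 gives 0
  on both sides.\<close>

lemma q_bernoulli_Suc:
  "- q_bernoulli (Suc n) q lam / of_nat (Suc n) =
    (\<Sum>j\<le>n. of_nat (n choose j) * (-1) ^ j * (1 / (1 - lam * q ^ Suc j))) / (1 - q) ^ n"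
proof -
  have "of_nat (Suc n choose Suc j) * (-1) ^ Suc j * (of_nat (Suc j) / d)
      = - of_nat (Suc n) * (of_nat (n choose j) * (-1) ^ j * (1 / d))" for j and d :: complex
  proof -
    have "of_nat (Suc n choose Suc j) * of_nat (Suc j) = (of_nat (Suc n) * of_nat (n choose j) :: complex)"
      using Suc_times_binomial[of j n] by (metis mult.commute of_nat_mult)
    then show ?thesis by (simp add: field_simps del: of_nat_Suc binomial_Suc_Suc)
  qed
  then have "q_bernoulli (Suc n) q lam = 1 / (1 - q) ^ n *
      (- of_nat (Suc n) * (\<Sum>j\<le>n. of_nat (n choose j) * (-1) ^ j * (1 / (1 - lam * q ^ Suc j))))"
    unfolding q_bernoulli_def atLeast0AtMost sum.atMost_Suc_shift sum_distrib_left[of "- of_nat (Suc n)"]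
    by simp
  then show ?thesis by (simp del: of_nat_Suc)
qed

theorem theorem15:
  fixes q lam :: complex and f k :: nat
  assumes "norm q < 1"
    and "f \<ge> 1"
    and "lam = exp (2 * of_real pi * \<i> / of_nat f)"
    and "k \<ge> 2"
  shows "q_lerch_zeta q lam (1 - of_nat k) = - q_bernoulli k q lam / of_nat k"
proof -
  obtain n where k: "k = Suc n" and n: "n > 0"
    using \<open>k \<ge> 2\<close> by (cases k) auto
  have lam: "norm lam = 1"
    unfolding assms(3) by (simp add: norm_exp_eq_Re)
  let ?a = "\<lambda>m. (q * lam) ^ m * (1 - q ^ m) ^ n"
  define S where "S = (\<Sum>j\<le>n. of_nat (n choose j) * (-1) ^ j * (1 / (1 - lam * q ^ Suc j)))"
  have summand: "q ^ Suc m * lam ^ Suc m / q_number q (Suc m) powr (1 - of_nat k)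
      = ?a (Suc m) / (1 - q) ^ n" for m
  proof -
    \<comment> \<open>The exponent is the integer \<open>- n\<close>, so the choice of branch does
      not matter and, the base being nonzero, \<open>powr\<close> is an ordinary power.\<close>
    have "q_number q (Suc m) powr (1 - of_nat k) = inverse (q_number q (Suc m) ^ n)"
      using q_number_Suc_nonzero[OF \<open>norm q < 1\<close>]
      by (simp add: k powr_minus powr_nat')
    then show ?thesis
      by (simp add: q_number_def power_divide power_mult_distrib mult.commute del: power_Suc)
  qed
  have "?a sums S"
    unfolding S_def using assms(1) lam by (intro sums_geometric_binomial) auto
  \<comment> \<open>Here \<open>n > 0\<close> matters: \<open>?a 0 = 0 ^ n\<close> is 0, whereas
    \<open>n = 0\<close> would make it 1, the defect seen at \<open>k = 1\<close>.\<close>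
  then have "(\<lambda>m. ?a (Suc m)) sums S"
    using n by (subst sums_Suc_iff) (simp add: zero_power)
  then have "(\<lambda>m. ?a (Suc m) / (1 - q) ^ n) sums (S / (1 - q) ^ n)"
    by (rule sums_divide)
  then have "q_lerch_zeta q lam (1 - of_nat k) = S / (1 - q) ^ n"
    unfolding q_lerch_zeta_def summand by (rule sums_unique[symmetric])
  then show ?thesis
    unfolding k q_bernoulli_Suc S_def .
qed

end
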